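(* Let $\sigma>0$ and $\beta>0$. Let $A:\mathcal{H}\to 2^{\mathcal{H}}$ be maximally monotone and $\sigma$-strongly monotone, and let $B:\mathcal{H}\to\mathcal{H}$ be maximally monotone and $\tfrac{1}{\beta}$-cocoercive. Let $\alpha\in(0,1)$ and $\gamma\in(0,\infty)$, and let the Douglas-Rachford algorithm $$z^{k+1}=\big((1-\alpha)\mathrm{Id}+\alpha R_{\gamma A}R_{\gamma B}\big)z^k$$ be applied to solve $0\in\gamma Ax+\gamma Bx$. Then the algorithm converges at least with rate factor $$\left|1-2\alpha+\alpha\frac{\frac{1}{\gamma\sigma}+\gamma\beta}{1+\frac{1}{\gamma\sigma}+\gamma\beta}\right|+\alpha\frac{\frac{1}{\gamma\sigma}+\gamma\beta}{1+\frac{1}{\gamma\sigma}+\gamma\beta}.$$ Moreover, minimizing this rate bound with respect to $\alpha\in(0,1)$ and $\gamma\in(0,\infty)$ gives $\gamma=\frac{1}{\sqrt{\beta\sigma}}$ and $\alpha=\frac{\sqrt{\beta/\sigma}+1/2}{1+\sqrt{\beta/\sigma}}$, and the corresponding optimal rate bound is $\frac{\sqrt{\beta/\sigma}}{\sqrt{\beta/\sigma}+1}$.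
   Context: $\mathcal{H}$ is a separable real Hilbert space. An operator $A:\mathcal{H}\to2^{\mathcal{H}}$ is $\sigma$-strongly monotone if $\langle u-v,x-y\rangle\ge\sigma\|x-y\|^2$ for all $u\in Ax$, $v\in Ay$. A map $B:\mathcal{H}\to\mathcal{H}$ is $\tfrac1\beta$-cocoercive if $\langle Bx-By,x-y\rangle\ge\tfrac1\beta\|Bx-By\|^2$ for all $x,y\in\mathcal{H}$. For a maximally monotone operator $M$, the resolvent is $J_M=(\mathrm{Id}+M)^{-1}$ and the reflected resolvent is $R_M=2J_M-\mathrm{Id}$; both are single-valued with full domain. The algorithm "converges at least with rate factor $\rho$" means that $\rho\in[0,1)$, that the iteration operator $T=(1-\alpha)\mathrm{Id}+\alpha R_{\gamma A}R_{\gamma B}$ has a unique fixed point $\bar z$, and that $\|z^{k+1}-\bar z\|\le\rho\|z^k-\bar z\|$ for all $k\geq 0$ and every starting point $z^0\in\mathcal{H}$. *)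

theory Defs
  imports "HOL-Analysis.Analysis"
begin

text \<open>
  Operators \<open>\<H> \<rightarrow> 2\<^sup>\<H>\<close> are functions of type \<open>'a \<Rightarrow> 'a set\<close>; a single-valued map enters through
  \<open>op_of\<close>.
\<close>

definition op_of :: "('a \<Rightarrow> 'a) \<Rightarrow> 'a \<Rightarrow> 'a set" where
  "op_of B x = {B x}"

definition op_add :: "('a::real_vector \<Rightarrow> 'a set) \<Rightarrow> ('a \<Rightarrow> 'a set) \<Rightarrow> 'a \<Rightarrow> 'a set" where
  "op_add M N x = {u + v |u v. u \<in> M x \<and> v \<in> N x}"

definition op_scale :: "real \<Rightarrow> ('a::real_vector \<Rightarrow> 'a set) \<Rightarrow> 'a \<Rightarrow> 'a set" where
  "op_scale c M x = {c *\<^sub>R u |u. u \<in> M x}"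

definition op_inverse :: "('a \<Rightarrow> 'a set) \<Rightarrow> 'a \<Rightarrow> 'a set" where
  "op_inverse M u = {x. u \<in> M x}"

definition monotone_op :: "('a::real_inner \<Rightarrow> 'a set) \<Rightarrow> bool" where
  "monotone_op M \<longleftrightarrow> (\<forall>x y. \<forall>u\<in>M x. \<forall>v\<in>M y. inner (u - v) (x - y) \<ge> 0)"

definition maximally_monotone :: "('a::real_inner \<Rightarrow> 'a set) \<Rightarrow> bool" where
  "maximally_monotone M \<longleftrightarrow>
     monotone_op M \<and> (\<forall>N. monotone_op N \<and> (\<forall>x. M x \<subseteq> N x) \<longrightarrow> N = M)"

definition strongly_monotone :: "real \<Rightarrow> ('a::real_inner \<Rightarrow> 'a set) \<Rightarrow> bool" where
  "strongly_monotone \<sigma> M \<longleftrightarrow>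
     (\<forall>x y. \<forall>u\<in>M x. \<forall>v\<in>M y. inner (u - v) (x - y) \<ge> \<sigma> * (norm (x - y))\<^sup>2)"

definition cocoercive :: "real \<Rightarrow> ('a::real_inner \<Rightarrow> 'a) \<Rightarrow> bool" where
  "cocoercive c B \<longleftrightarrow> (\<forall>x y. inner (B x - B y) (x - y) \<ge> c * (norm (B x - B y))\<^sup>2)"

text \<open>
  For maximally monotone \<open>M\<close>, \<open>(Id + M)\<close> has a single-valued inverse with full domain (Minty), so
  \<open>the_elem\<close> below is applied to singletons only.
\<close>

definition resolvent :: "('a::real_inner \<Rightarrow> 'a set) \<Rightarrow> 'a \<Rightarrow> 'a" where
  "resolvent M z = the_elem (op_inverse (op_add (op_of id) M) z)"

definition reflected_resolvent :: "('a::real_inner \<Rightarrow> 'a set) \<Rightarrow> 'a \<Rightarrow> 'a" where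
  "reflected_resolvent M z = 2 *\<^sub>R resolvent M z - z"

definition DR_operator ::
  "real \<Rightarrow> real \<Rightarrow> ('a::real_inner \<Rightarrow> 'a set) \<Rightarrow> ('a \<Rightarrow> 'a) \<Rightarrow> 'a \<Rightarrow> 'a" where
  "DR_operator \<alpha> \<gamma> A B z =
     (1 - \<alpha>) *\<^sub>R z +
     \<alpha> *\<^sub>R reflected_resolvent (op_scale \<gamma> A) (reflected_resolvent (op_scale \<gamma> (op_of B)) z)"

definition converges_with_rate :: "('a::real_normed_vector \<Rightarrow> 'a) \<Rightarrow> real \<Rightarrow> bool" where
  "converges_with_rate T \<rho> \<longleftrightarrow>
     0 \<le> \<rho> \<and> \<rho> < 1 \<and>
     (\<exists>zbar. (\<forall>z. T z = z \<longleftrightarrow> z = zbar) \<and>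
        (\<forall>z :: nat \<Rightarrow> 'a. (\<forall>k. z (Suc k) = T (z k)) \<longrightarrow>
           (\<forall>k. norm (z (Suc k) - zbar) \<le> \<rho> * norm (z k - zbar))))"

definition DR_rate :: "real \<Rightarrow> real \<Rightarrow> real \<Rightarrow> real \<Rightarrow> real" where
  "DR_rate \<sigma> \<beta> \<alpha> \<gamma> =
     (let \<delta> = (1 / (\<gamma> * \<sigma>) + \<gamma> * \<beta>) / (1 + 1 / (\<gamma> * \<sigma>) + \<gamma> * \<beta>)
      in \<bar>1 - 2 * \<alpha> + \<alpha> * \<delta>\<bar> + \<alpha> * \<delta>)"

end

theory Submission
  imports Defs
begin

text \<open>
  Put \<open>\<kappa>\<^sub>1 = 1 / (\<gamma> \<sigma>)\<close> and \<open>\<kappa>\<^sub>2 = \<gamma> \<beta>\<close>. Strong monotonicity of \<open>A\<close> makes \<open>- R\<^bsub>\<gamma>A\<^esub>\<close> averaged with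
  constant \<open>\<kappa>\<^sub>1 / (1 + \<kappa>\<^sub>1)\<close>, and cocoercivity of \<open>B\<close> makes \<open>R\<^bsub>\<gamma>B\<^esub>\<close> averaged with constant
  \<open>\<kappa>\<^sub>2 / (1 + \<kappa>\<^sub>2)\<close>. In terms of the parameters \<open>\<kappa>\<close>, composing averaged maps adds the parameters, so
  \<open>- R\<^bsub>\<gamma>A\<^esub> R\<^bsub>\<gamma>B\<^esub>\<close> is averaged with constant \<open>\<delta> = \<kappa> / (1 + \<kappa>)\<close>, \<open>\<kappa> = \<kappa>\<^sub>1 + \<kappa>\<^sub>2\<close>; that is, it differs
  from \<open>(1 - \<delta>) Id\<close> by a \<open>\<delta>\<close>-Lipschitz map. Consequently the iteration operator is
  \<open>(1 - 2 \<alpha> + \<alpha> \<delta>) Id\<close> plus an \<open>\<alpha> \<delta>\<close>-Lipschitz map, hence a contraction with the stated factor, and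
  Banach's theorem applies.

  That the resolvents exist is Minty's theorem. Following Simons and Zalinescu, the Fitzpatrick
  function plus half the squared norm has a minimizer by completeness and the parallelogram law,
  and the first-order optimality condition at the minimizer, tested on the graph of the operator,
  yields a zero of \<open>Id + M\<close>.

  For the optimal parameters, the rate factor for fixed \<open>\<delta>\<close> is minimal exactly at
  \<open>\<alpha> = 1 / (2 - \<delta>)\<close>, where the absolute value vanishes; the minimal value \<open>\<delta> / (2 - \<delta>) = \<kappa> / (2 + \<kappa>)\<close>
  is increasing in \<open>\<kappa>\<close>, and \<open>\<kappa>\<close> is minimal exactly at \<open>\<gamma> = 1 / sqrt (\<beta> \<sigma>)\<close> by the
  arithmetic-geometric mean inequality.
\<close>

section \<open>Minty's theorem\<close>

text \<open>
  The set \<open>S\<close> plays the role of the epigraph of a convex lower semicontinuous function \<open>f\<close>; the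
  conclusion says that \<open>f p + (norm p)\<^sup>2 / 2\<close> attains its minimum.
\<close>

lemma epigraph_plus_norm_attains_min:
  fixes S :: "('b::{real_inner,complete_space} \<times> real) set"
  assumes "closed S" "convex S" "S \<noteq> {}"
    and bnd: "\<And>p t. (p, t) \<in> S \<Longrightarrow> 0 \<le> t + (norm p)\<^sup>2 / 2"
  obtains p0 t0 where "(p0, t0) \<in> S"
    "\<And>p t. (p, t) \<in> S \<Longrightarrow> t0 + (norm p0)\<^sup>2 / 2 \<le> t + (norm p)\<^sup>2 / 2"
proof -
  define g :: "'b \<times> real \<Rightarrow> real" where "g = (\<lambda>(p, t). t + (norm p)\<^sup>2 / 2)"
  define m where "m = Inf (g ` S)"
  have bdd: "bdd_below (g ` S)"
    by (rule bdd_belowI[of _ 0]) (auto simp: g_def bnd)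
  have m_le: "m \<le> g q" if "q \<in> S" for q
    unfolding m_def using bdd that by (intro cInf_lower) auto
  have "\<exists>q\<in>S. g q < m + 1 / real (Suc n)" for n
  proof -
    have "Inf (g ` S) < m + 1 / real (Suc n)" by (simp add: m_def)
    then show ?thesis
      using assms(3) bdd by (subst (asm) cInf_less_iff) auto
  qed
  then obtain q where qS: "\<And>n. q n \<in> S" and qm: "\<And>n. g (q n) < m + 1 / real (Suc n)"
    by metis
  define p where "p = (\<lambda>n. fst (q n))"
  define t where "t = (\<lambda>n. snd (q n))"
  have q_eq: "q n = (p n, t n)" for n by (simp add: p_def t_def)
  \<comment> \<open>By the parallelogram law, the value at a midpoint would drop below the infimum if two
    almost minimal points were far apart.\<close>
  have dist_le: "(norm (p i - p j))\<^sup>2 \<le> 4 * (1 / real (Suc i) + 1 / real (Suc j))" for i j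
  proof -
    have "(1/2) *\<^sub>R q i + (1/2) *\<^sub>R q j \<in> S"
      using \<open>convex S\<close> qS by (intro convexD) auto
    then have "m \<le> g ((1/2) *\<^sub>R q i + (1/2) *\<^sub>R q j)" by (rule m_le)
    also have "\<dots> = (g (q i) + g (q j)) / 2 - (norm (p i - p j))\<^sup>2 / 8"
      unfolding g_def q_eq
      by (simp add: power2_norm_eq_inner inner_simps inner_commute field_simps)
    finally show ?thesis using qm[of i] qm[of j] by argo
  qed
  have "Cauchy p"
  proof (rule metric_CauchyI)
    fix e :: real assume "e > 0"
    then obtain N where N: "inverse (real (Suc N)) < e\<^sup>2 / 8"
      using reals_Archimedean[of "e\<^sup>2 / 8"] by auto
    have "dist (p i) (p j) < e" if "i \<ge> N" "j \<ge> N" for i j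
    proof -
      have "1 / real (Suc i) \<le> 1 / real (Suc N)" "1 / real (Suc j) \<le> 1 / real (Suc N)"
        using that by (auto simp: frac_le)
      moreover have "1 / real (Suc N) < e\<^sup>2 / 8" using N by (simp add: inverse_eq_divide)
      ultimately have "(norm (p i - p j))\<^sup>2 < e\<^sup>2" using dist_le[of i j] by argo
      then show ?thesis using \<open>e > 0\<close> by (simp add: dist_norm power2_less_imp_less)
    qed
    then show "\<exists>M. \<forall>i\<ge>M. \<forall>j\<ge>M. dist (p i) (p j) < e" by blast
  qed
  then obtain p0 where p0: "p \<longlonglongrightarrow> p0"
    using Cauchy_convergent convergent_def by blast
  have "(\<lambda>n. g (q n)) \<longlonglongrightarrow> m"
  proof (rule tendsto_sandwich[of "\<lambda>_. m" _ _ "\<lambda>n. m + 1 / real (Suc n)"])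
    show "(\<lambda>n. m + 1 / real (Suc n)) \<longlonglongrightarrow> m"
      using tendsto_add[OF tendsto_const[of m] LIMSEQ_Suc[OF lim_1_over_n]] by simp
      show "\<forall>\<^sub>F n in sequentially. g (q n) \<le> m + 1 / real (Suc n)"
      by (intro always_eventually allI less_imp_le qm)
  qed (use m_le qS in auto)
  then have "(\<lambda>n. g (q n) - (norm (p n))\<^sup>2 / 2) \<longlonglongrightarrow> m - (norm p0)\<^sup>2 / 2"
    using p0 by (intro tendsto_intros) auto
  moreover have "(\<lambda>n. g (q n) - (norm (p n))\<^sup>2 / 2) = t"
    by (simp add: g_def q_eq fun_eq_iff)
  ultimately have t0: "t \<longlonglongrightarrow> m - (norm p0)\<^sup>2 / 2" by simp
  have "q \<longlonglongrightarrow> (p0, m - (norm p0)\<^sup>2 / 2)"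
    using tendsto_Pair[OF p0 t0] by (simp flip: q_eq)
  then have "(p0, m - (norm p0)\<^sup>2 / 2) \<in> S"
    using closed_sequentially[OF \<open>closed S\<close>] qS by blast
  moreover have "m - (norm p0)\<^sup>2 / 2 + (norm p0)\<^sup>2 / 2 \<le> t + (norm p)\<^sup>2 / 2" if "(p, t) \<in> S" for p t
    using m_le[OF that] by (simp add: g_def)
  ultimately show ?thesis using that by blast
qed

text \<open>
  First-order optimality at the minimizer: \<open>- p0\<close> is a subgradient at \<open>p0\<close> of the function with
  epigraph \<open>S\<close>, as \<open>t0 + inner (- p0) (p - p0) \<le> t\<close>.
\<close>

lemma epigraph_plus_norm_subgradient:
  fixes S :: "('b::{real_inner,complete_space} \<times> real) set"
  assumes "closed S" "convex S" "S \<noteq> {}"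
    and "\<And>p t. (p, t) \<in> S \<Longrightarrow> 0 \<le> t + (norm p)\<^sup>2 / 2"
  obtains p0 t0 where "(p0, t0) \<in> S"
    "\<And>p t. (p, t) \<in> S \<Longrightarrow> t0 + (norm p0)\<^sup>2 \<le> t + inner p0 p"
proof -
  \<comment> \<open>Compare the minimizer with nearby points of the segment to \<open>(p, t)\<close>, and let \<open>s\<close> tend to 0.\<close>
  obtain p0 t0 where S0: "(p0, t0) \<in> S"
    and min: "\<And>p t. (p, t) \<in> S \<Longrightarrow> t0 + (norm p0)\<^sup>2 / 2 \<le> t + (norm p)\<^sup>2 / 2"
    using epigraph_plus_norm_attains_min[OF assms] by blast
  have "t0 + (norm p0)\<^sup>2 \<le> t + inner p0 p" if St: "(p, t) \<in> S" for p t
  proof -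
    define c where "c = t - t0 + inner p0 (p - p0)"
    define d where "d = (norm (p - p0))\<^sup>2 / 2"
    have ineq: "0 \<le> c + s * d" if s: "0 < s" "s < 1" for s
    proof -
      have "(1 - s) *\<^sub>R (p0, t0) + s *\<^sub>R (p, t) \<in> S"
        using \<open>convex S\<close> S0 St s by (intro convexD) auto
      then have "((1 - s) *\<^sub>R p0 + s *\<^sub>R p, (1 - s) * t0 + s * t) \<in> S" by simp
      from min[OF this]
      have "0 \<le> s * (c + s * d)"
        unfolding c_def d_def power2_norm_eq_inner
        by (simp add: inner_simps inner_commute field_simps)
      then show ?thesis using s by (simp add: zero_le_mult_iff)
    qed
    have "((\<lambda>s. c + s * d) \<longlongrightarrow> c + 0 * d) (at_right 0)"
      by (intro tendsto_intros)
    moreover have "eventually (\<lambda>s. 0 \<le> c + s * d) (at_right 0)"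
      using ineq by (auto simp: eventually_at_right[of 0 1] intro!: exI[of _ 1])
    ultimately have "0 \<le> c + 0 * d"
      by (intro tendsto_lowerbound) auto
    then show ?thesis
      by (simp add: c_def inner_simps power2_norm_eq_inner)
  qed
  then show ?thesis using that S0 by blast
qed

text \<open>
  Maximality in its usable form: every pair monotonically related to the graph lies in the graph.
\<close>

lemma maximally_monotoneD:
  assumes "maximally_monotone M"
    and "\<And>y v. v \<in> M y \<Longrightarrow> inner (u - v) (x - y) \<ge> 0"
  shows "u \<in> M x"
proof -
  define N where "N = (\<lambda>y. if y = x then insert u (M y) else M y)"
  have "monotone_op M" using assms(1) by (simp add: maximally_monotone_def)
  moreover have "inner (v - u) (y - x) \<ge> 0" if "v \<in> M y" for y v
    using assms(2)[OF that] by (simp add: inner_simps)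
  ultimately have "monotone_op N"
    using assms(2) by (auto simp: monotone_op_def N_def)
  moreover have "\<forall>y. M y \<subseteq> N y" by (auto simp: N_def)
  ultimately have "N = M" using assms(1) unfolding maximally_monotone_def by blast
  moreover have "u \<in> N x" by (simp add: N_def)
  ultimately show ?thesis by simp
qed

lemma maximally_monotoneI:
  assumes "monotone_op M"
    and max: "\<And>x u. (\<And>y v. v \<in> M y \<Longrightarrow> inner (u - v) (x - y) \<ge> 0) \<Longrightarrow> u \<in> M x"
  shows "maximally_monotone M"
  unfolding maximally_monotone_def
proof (intro conjI allI impI)
  fix N assume N: "monotone_op N \<and> (\<forall>x. M x \<subseteq> N x)"
  have "u \<in> M x" if "u \<in> N x" for x u
    using N that by (intro max) (force simp: monotone_op_def)
  then show "N = M" using N by (intro ext) blast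
qed fact

lemma monotone_opD:
  "monotone_op M \<Longrightarrow> u \<in> M x \<Longrightarrow> v \<in> M y \<Longrightarrow> inner (u - v) (x - y) \<ge> 0"
  by (simp add: monotone_op_def)

lemma maximally_monotone_imp_monotone: "maximally_monotone M \<Longrightarrow> monotone_op M"
  by (simp add: maximally_monotone_def)

lemma maximally_monotone_op_scale:
  assumes "maximally_monotone M" "c > 0"
  shows "maximally_monotone (op_scale c M)"
proof (rule maximally_monotoneI)
  have "inner (c *\<^sub>R u - c *\<^sub>R v) (x - y) \<ge> 0" if "u \<in> M x" "v \<in> M y" for x y u v
    using monotone_opD[OF maximally_monotone_imp_monotone[OF assms(1)] that] \<open>c > 0\<close>
    by (simp flip: scaleR_diff_right)
  then show "monotone_op (op_scale c M)"
    by (auto simp: monotone_op_def op_scale_def)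
next
  fix x u assume *: "\<And>y v. v \<in> op_scale c M y \<Longrightarrow> inner (u - v) (x - y) \<ge> 0"
  have "(1 / c) *\<^sub>R u \<in> M x"
  proof (rule maximally_monotoneD[OF assms(1)])
    fix y v assume "v \<in> M y"
    then have "inner (u - c *\<^sub>R v) (x - y) \<ge> 0" by (intro *) (auto simp: op_scale_def)
    moreover have "(1 / c) *\<^sub>R u - v = (1 / c) *\<^sub>R (u - c *\<^sub>R v)"
      using \<open>c > 0\<close> by (simp add: scaleR_diff_right)
    ultimately show "inner ((1 / c) *\<^sub>R u - v) (x - y) \<ge> 0" using \<open>c > 0\<close> by simp
  qed
  then show "u \<in> op_scale c M x"
    using \<open>c > 0\<close> by (auto simp: op_scale_def intro!: exI[of _ "(1 / c) *\<^sub>R u"])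
qed

lemma maximally_monotone_translate:
  assumes "maximally_monotone M"
  shows "maximally_monotone (\<lambda>x. {u. u + z \<in> M x})"
proof (rule maximally_monotoneI)
  show "monotone_op (\<lambda>x. {u. u + z \<in> M x})"
    using monotone_opD[OF maximally_monotone_imp_monotone[OF assms]]
    by (fastforce simp: monotone_op_def)
next
  fix x u assume *: "\<And>y v. v \<in> {u. u + z \<in> M y} \<Longrightarrow> inner (u - v) (x - y) \<ge> 0"
  have "u + z \<in> M x"
  proof (rule maximally_monotoneD[OF assms])
    fix y v assume "v \<in> M y"
    then show "inner (u + z - v) (x - y) \<ge> 0"
      using *[of "v - z" y] by (simp add: algebra_simps)
  qed
  then show "u \<in> {u. u + z \<in> M x}" by simp
qed

text \<open>
  The set \<open>S\<close> in the proof is the epigraph of the Fitzpatrick function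
  \<open>F (x, u) = sup {inner x v + inner y u - inner y v | v \<in> M y}\<close>, which majorizes \<open>inner x u\<close>
  everywhere and equals it on the graph of \<open>M\<close>.
\<close>

lemma minty_zero:
  fixes M :: "'a::{real_inner,complete_space} \<Rightarrow> 'a set"
  assumes "maximally_monotone M"
  shows "\<exists>x. - x \<in> M x"
proof -
  note mono = monotone_opD[OF maximally_monotone_imp_monotone[OF assms]]
  define H where "H = (\<lambda>(y::'a) v. {((x, u), t). inner x v + inner y u - inner y v \<le> (t::real)})"
  define S :: "(('a \<times> 'a) \<times> real) set" where "S = (\<Inter>y. \<Inter>v\<in>M y. H y v)"
  have H_alt: "H y v = {q. inner (fst (fst q)) v + inner y (snd (fst q)) - inner y v \<le> snd q}" for y v
    by (auto simp: H_def)
  have "closed (H y v)" for y v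
    unfolding H_alt by (intro closed_Collect_le continuous_intros)
  then have "closed S" unfolding S_def by auto
  have "convex (H y v)" for y v
  proof (rule convexI)
    fix q r and a b :: real assume "q \<in> H y v" "r \<in> H y v" "0 \<le> a" "0 \<le> b" "a + b = 1"
    moreover from this have
      "a * (inner (fst (fst q)) v + inner y (snd (fst q)) - inner y v) +
       b * (inner (fst (fst r)) v + inner y (snd (fst r)) - inner y v) \<le> a * snd q + b * snd r"
      by (intro add_mono mult_left_mono) (auto simp: H_alt)
    moreover have "inner y v = a * inner y v + b * inner y v"
      using \<open>a + b = 1\<close> by (simp flip: distrib_right)
    ultimately show "a *\<^sub>R q + b *\<^sub>R r \<in> H y v"
      by (simp add: H_alt inner_simps algebra_simps)
  qed
  then have "convex S" unfolding S_def by (intro convex_INT) auto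
  have graph_S: "((y, v), inner y v) \<in> S" if "v \<in> M y" for y v
  proof -
    have "inner y w + inner x v - inner x w \<le> inner y v" if "w \<in> M x" for x w
      using mono[OF \<open>v \<in> M y\<close> that] by (simp add: inner_simps inner_commute)
    then show ?thesis by (auto simp: S_def H_def)
  qed
  have S_ge: "inner x u \<le> t" if "((x, u), t) \<in> S" for x u t
  proof (cases "u \<in> M x")
    case True
    with that have "inner x u + inner x u - inner x u \<le> t" unfolding S_def H_def by blast
    then show ?thesis by simp
  next
    case False
    then obtain y v where "v \<in> M y" "inner (u - v) (x - y) < 0"
      using maximally_monotoneD[OF assms, of u x] by (meson not_le)
    moreover from this that have "inner x v + inner y u - inner y v \<le> t"
      by (auto simp: S_def H_def)
    ultimately show ?thesis by (simp add: inner_simps inner_commute)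
  qed
  have norm_prod: "(norm (x, u))\<^sup>2 = inner x x + inner u u" for x u :: 'a
    by (simp add: power2_norm_eq_inner)
  have sq: "inner (x + u) (x + u) = inner x x + inner u u + 2 * inner x u" for x u :: 'a
    by (simp add: inner_simps inner_commute)
  have "S \<noteq> {}"
  proof -
    obtain x u where "u \<in> M x"
      using maximally_monotoneD[OF assms, of 0 0] by blast
    then show ?thesis using graph_S by blast
  qed
  moreover have "0 \<le> t + (norm p)\<^sup>2 / 2" if "(p, t) \<in> S" for p t
  proof (cases p)
    case (Pair x u)
    then show ?thesis
      using S_ge[of x u t] that sq[of x u] inner_ge_zero[of "x + u"]
      by (simp only: Pair norm_prod) (simp add: field_simps)
  qed
  ultimately obtain p0 t0 where p0: "(p0, t0) \<in> S"
    "\<And>p t. (p, t) \<in> S \<Longrightarrow> t0 + (norm p0)\<^sup>2 \<le> t + inner p0 p"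
    using epigraph_plus_norm_subgradient[OF \<open>closed S\<close> \<open>convex S\<close>] by blast
  obtain x0 u0 where p0_eq: "p0 = (x0, u0)" by force
  have key: "inner (x0 + u0) (x0 + u0) \<le> inner (y + u0) (v + x0)" if "v \<in> M y" for y v
  proof -
    have "t0 + (norm (x0, u0))\<^sup>2 \<le> inner y v + inner (x0, u0) (y, v)"
      using p0(2)[OF graph_S[OF that]] by (simp only: p0_eq)
    moreover have "inner x0 u0 \<le> t0" using p0(1) S_ge by (simp add: p0_eq)
    ultimately show ?thesis
      unfolding norm_prod sq by (simp add: inner_simps inner_commute)
  qed
  \<comment> \<open>So \<open>(- u0, - x0)\<close> is monotonically related to the graph; once it lies in the graph, testing
    \<open>key\<close> there forces \<open>x0 + u0 = 0\<close>.\<close>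
  have "- x0 \<in> M (- u0)"
  proof (rule maximally_monotoneD[OF assms])
    fix y v assume "v \<in> M y"
    from key[OF this] have "0 \<le> inner (y + u0) (v + x0)"
      using inner_ge_zero[of "x0 + u0"] by linarith
    also have "\<dots> = inner (- x0 - v) (- u0 - y)"
      by (simp add: inner_simps inner_commute)
    finally show "0 \<le> inner (- x0 - v) (- u0 - y)" .
  qed
  moreover from key[OF this] have "inner (x0 + u0) (x0 + u0) \<le> 0" by simp
  then have "inner (x0 + u0) (x0 + u0) = 0"
    using inner_ge_zero by (rule order_antisym)
  then have "x0 + u0 = 0" by simp
  then have "u0 = - x0" by (simp add: eq_neg_iff_add_eq_0 add.commute)
  ultimately show ?thesis by auto
qed

theorem minty:
  fixes M :: "'a::{real_inner,complete_space} \<Rightarrow> 'a set"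
  assumes "maximally_monotone M"
  shows "\<exists>x. z - x \<in> M x"
  using minty_zero[OF maximally_monotone_translate[OF assms, of z]] by simp

lemma resolvent_mem:
  fixes M :: "'a::{real_inner,complete_space} \<Rightarrow> 'a set"
  assumes "maximally_monotone M"
  shows "z - resolvent M z \<in> M (resolvent M z)"
proof -
  have eq: "op_inverse (op_add (op_of id) M) z = {x. z - x \<in> M x}"
    by (force simp: op_inverse_def op_add_def op_of_def)
  obtain x where x: "z - x \<in> M x" using minty[OF assms] by blast
  have "y = x" if "z - y \<in> M y" for y
  proof -
    have "0 \<le> inner ((z - y) - (z - x)) (y - x)"
      by (rule monotone_opD[OF maximally_monotone_imp_monotone[OF assms] that x])
    also have "\<dots> = - inner (y - x) (y - x)" by (simp add: inner_simps inner_commute)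
    finally have "inner (y - x) (y - x) = 0" using inner_ge_zero[of "y - x"] by linarith
    then show ?thesis by simp
  qed
  with x have "{x. z - x \<in> M x} = {x}" by blast
  then have "resolvent M z = x" by (simp add: resolvent_def eq)
  with x show ?thesis by simp
qed

section \<open>Averaged maps and the contraction factor\<close>

text \<open>
  For \<open>\<kappa> > 0\<close> this is the usual notion of a \<open>\<theta>\<close>-averaged map, \<open>T = (1 - \<theta>) Id + \<theta> N\<close> with \<open>N\<close>
  nonexpansive, for \<open>\<theta> = \<kappa> / (1 + \<kappa>)\<close>. The parameter \<open>\<kappa> = \<theta> / (1 - \<theta>)\<close> is used because it is
  additive under composition.
\<close>

definition averaged_map :: "real \<Rightarrow> ('a::real_inner \<Rightarrow> 'a) \<Rightarrow> bool" where
  "averaged_map \<kappa> T \<longleftrightarrow>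
     (\<forall>x y. (norm ((x - y) - (T x - T y)))\<^sup>2 \<le> \<kappa> * ((norm (x - y))\<^sup>2 - (norm (T x - T y))\<^sup>2))"

lemma averaged_map_reflected_resolvent_strongly_monotone:
  fixes A :: "'a::{real_inner,complete_space} \<Rightarrow> 'a set"
  assumes "maximally_monotone A" "strongly_monotone \<sigma> A" "\<sigma> > 0" "\<gamma> > 0"
  shows "averaged_map (1 / (\<gamma> * \<sigma>)) (\<lambda>z. - reflected_resolvent (op_scale \<gamma> A) z)"
  unfolding averaged_map_def
proof (intro allI)
  fix x y :: 'a
  let ?J = "resolvent (op_scale \<gamma> A)"
  define d where "d = x - y"
  define j where "j = ?J x - ?J y"
  have mem: "z - ?J z \<in> op_scale \<gamma> A (?J z)" for z
    by (rule resolvent_mem[OF maximally_monotone_op_scale[OF assms(1,4)]])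
  obtain u v where u: "u \<in> A (?J x)" "x - ?J x = \<gamma> *\<^sub>R u"
    and v: "v \<in> A (?J y)" "y - ?J y = \<gamma> *\<^sub>R v"
    using mem[of x] mem[of y] by (auto simp: op_scale_def)
  have "\<sigma> * (norm j)\<^sup>2 \<le> inner (u - v) j"
    using assms(2) u(1) v(1) unfolding strongly_monotone_def j_def by blast
  then have "\<gamma> * (\<sigma> * (norm j)\<^sup>2) \<le> \<gamma> * inner (u - v) j"
    using \<open>\<gamma> > 0\<close> by (intro mult_left_mono) auto
  also have "\<dots> = inner (\<gamma> *\<^sub>R u - \<gamma> *\<^sub>R v) j" by (simp add: inner_simps algebra_simps)
  also have "\<gamma> *\<^sub>R u - \<gamma> *\<^sub>R v = d - j"
    by (simp add: d_def j_def flip: u(2) v(2))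
  finally have *: "\<gamma> * \<sigma> * (norm j)\<^sup>2 \<le> inner d j - inner j j" by (simp add: inner_simps)
  have diff: "- reflected_resolvent (op_scale \<gamma> A) x - - reflected_resolvent (op_scale \<gamma> A) y
      = d - 2 *\<^sub>R j"
    by (simp add: reflected_resolvent_def d_def j_def algebra_simps)
  have "(norm (d - (d - 2 *\<^sub>R j)))\<^sup>2 = 4 * (norm j)\<^sup>2"
    by (simp add: power_mult_distrib)
  also have "\<dots> = 1 / (\<gamma> * \<sigma>) * (4 * (\<gamma> * \<sigma> * (norm j)\<^sup>2))" using assms by simp
  also have "\<dots> \<le> 1 / (\<gamma> * \<sigma>) * (4 * (inner d j - inner j j))"
    using * assms by (intro mult_left_mono) auto
  also have "4 * (inner d j - inner j j) = (norm d)\<^sup>2 - (norm (d - 2 *\<^sub>R j))\<^sup>2"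
    by (simp add: power2_norm_eq_inner inner_simps inner_commute)
  finally show "(norm ((x - y) - (- reflected_resolvent (op_scale \<gamma> A) x -
        - reflected_resolvent (op_scale \<gamma> A) y)))\<^sup>2
      \<le> 1 / (\<gamma> * \<sigma>) * ((norm (x - y))\<^sup>2 - (norm (- reflected_resolvent (op_scale \<gamma> A) x -
        - reflected_resolvent (op_scale \<gamma> A) y))\<^sup>2)"
    unfolding diff d_def .
qed

lemma averaged_map_reflected_resolvent_cocoercive:
  fixes B :: "'a::{real_inner,complete_space} \<Rightarrow> 'a"
  assumes "maximally_monotone (op_of B)" "cocoercive (1 / \<beta>) B" "\<beta> > 0" "\<gamma> > 0"
  shows "averaged_map (\<gamma> * \<beta>) (reflected_resolvent (op_scale \<gamma> (op_of B)))"
  unfolding averaged_map_def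
proof (intro allI)
  fix x y :: 'a
  let ?J = "resolvent (op_scale \<gamma> (op_of B))"
  define d where "d = x - y"
  define b where "b = B (?J x) - B (?J y)"
  have "z - ?J z \<in> op_scale \<gamma> (op_of B) (?J z)" for z
    by (rule resolvent_mem[OF maximally_monotone_op_scale[OF assms(1,4)]])
  then have "z - ?J z = \<gamma> *\<^sub>R B (?J z)" for z
    by (auto simp: op_scale_def op_of_def)
  then have J: "?J z = z - \<gamma> *\<^sub>R B (?J z)" for z
    by (simp add: algebra_simps)
  have "?J x - ?J y = d - \<gamma> *\<^sub>R b"
    by (subst J[of x], subst J[of y]) (simp add: d_def b_def algebra_simps)
  moreover have "1 / \<beta> * (norm b)\<^sup>2 \<le> inner b (?J x - ?J y)"
    using assms(2) unfolding cocoercive_def b_def by blast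
  ultimately have "1 / \<beta> * (norm b)\<^sup>2 \<le> inner d b - \<gamma> * inner b b"
    by (simp add: inner_simps inner_commute)
  then have *: "(norm b)\<^sup>2 \<le> \<beta> * (inner d b - \<gamma> * inner b b)"
    using \<open>\<beta> > 0\<close> by (simp add: field_simps)
  have diff: "reflected_resolvent (op_scale \<gamma> (op_of B)) x - reflected_resolvent (op_scale \<gamma> (op_of B)) y
      = d - (2 * \<gamma>) *\<^sub>R b"
    unfolding reflected_resolvent_def
    by (subst J[of x], subst J[of y]) (simp add: d_def b_def algebra_simps scaleR_2)
  have "(norm (d - (d - (2 * \<gamma>) *\<^sub>R b)))\<^sup>2 = 4 * \<gamma>\<^sup>2 * (norm b)\<^sup>2"
    by (simp add: power_mult_distrib)
  also have "\<dots> \<le> 4 * \<gamma>\<^sup>2 * (\<beta> * (inner d b - \<gamma> * inner b b))"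
    using * by (intro mult_left_mono) auto
  also have "\<dots> = \<gamma> * \<beta> * ((norm d)\<^sup>2 - (norm (d - (2 * \<gamma>) *\<^sub>R b))\<^sup>2)"
    unfolding power2_norm_eq_inner
    by (simp add: inner_simps inner_commute algebra_simps power2_eq_square)
  finally show "(norm ((x - y) - (reflected_resolvent (op_scale \<gamma> (op_of B)) x -
        reflected_resolvent (op_scale \<gamma> (op_of B)) y)))\<^sup>2
      \<le> \<gamma> * \<beta> * ((norm (x - y))\<^sup>2 - (norm (reflected_resolvent (op_scale \<gamma> (op_of B)) x -
        reflected_resolvent (op_scale \<gamma> (op_of B)) y))\<^sup>2)"
    unfolding diff d_def .
qed

text \<open>The Cauchy-Schwarz inequality that makes the parameters of averaged maps add up.\<close>

lemma power2_norm_add_le_mult: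
  fixes p q :: "'a::real_normed_vector"
  assumes "(norm p)\<^sup>2 \<le> a * X" "(norm q)\<^sup>2 \<le> b * Y" "a > 0" "b > 0"
  shows "(norm (p + q))\<^sup>2 \<le> (a + b) * (X + Y)"
proof -
  have "(norm p)\<^sup>2 / a \<le> X" "(norm q)\<^sup>2 / b \<le> Y"
    using assms by (simp_all add: field_simps)
  have "(norm (p + q))\<^sup>2 \<le> (norm p + norm q)\<^sup>2"
    by (intro power_mono norm_triangle_ineq) auto
  also have "\<dots> \<le> (norm p + norm q)\<^sup>2 + (b * norm p - a * norm q)\<^sup>2 / (a * b)"
    using assms by simp
  also have "\<dots> = (a + b) * ((norm p)\<^sup>2 / a + (norm q)\<^sup>2 / b)"
    using assms by (simp add: field_simps power2_eq_square)
  also have "\<dots> \<le> (a + b) * (X + Y)"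
    using assms \<open>(norm p)\<^sup>2 / a \<le> X\<close> \<open>(norm q)\<^sup>2 / b \<le> Y\<close> by (intro mult_left_mono add_mono) auto
  finally show ?thesis .
qed

lemma averaged_map_compose:
  assumes "averaged_map a S" "averaged_map b T" "a > 0" "b > 0"
  shows "averaged_map (a + b) (\<lambda>x. S (T x))"
  unfolding averaged_map_def
proof (intro allI)
  fix x y
  have "(norm (((T x - T y) - (S (T x) - S (T y))) + ((x - y) - (T x - T y))))\<^sup>2
      \<le> (a + b) * (((norm (T x - T y))\<^sup>2 - (norm (S (T x) - S (T y)))\<^sup>2)
                    + ((norm (x - y))\<^sup>2 - (norm (T x - T y))\<^sup>2))"
    using assms by (intro power2_norm_add_le_mult) (auto simp: averaged_map_def)
  then show "(norm ((x - y) - (S (T x) - S (T y))))\<^sup>2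
      \<le> (a + b) * ((norm (x - y))\<^sup>2 - (norm (S (T x) - S (T y)))\<^sup>2)"
    by (simp add: algebra_simps)
qed

lemma averaged_map_dist_le:
  assumes "averaged_map \<kappa> T" "\<kappa> > 0" and \<delta>: "\<delta> = \<kappa> / (1 + \<kappa>)"
  shows "norm ((T x - T y) - (1 - \<delta>) *\<^sub>R (x - y)) \<le> \<delta> * norm (x - y)"
proof -
  define d where "d = x - y"
  define f where "f = T x - T y"
  have "(norm (d - f))\<^sup>2 \<le> \<kappa> * ((norm d)\<^sup>2 - (norm f)\<^sup>2)"
    using assms(1) unfolding averaged_map_def d_def f_def by blast
  then have "(1 + \<kappa>) * inner f f - 2 * inner d f + (1 - \<kappa>) * inner d d \<le> 0"
    by (simp add: power2_norm_eq_inner inner_simps inner_commute algebra_simps)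
  then have "(1 + \<kappa>) * ((1 + \<kappa>) * inner f f - 2 * inner d f + (1 - \<kappa>) * inner d d) \<le> 0"
    using \<open>\<kappa> > 0\<close> by (simp add: mult_le_0_iff)
  then have "(norm ((1 + \<kappa>) *\<^sub>R f - d))\<^sup>2 \<le> (\<kappa> * norm d)\<^sup>2"
    unfolding power_mult_distrib power2_norm_eq_inner
    by (simp add: inner_simps inner_commute algebra_simps power2_eq_square)
  then have "norm ((1 + \<kappa>) *\<^sub>R f - d) \<le> \<kappa> * norm d"
    by (rule power2_le_imp_le) (use \<open>\<kappa> > 0\<close> in simp)
  moreover have "f - (1 - \<delta>) *\<^sub>R d = (1 / (1 + \<kappa>)) *\<^sub>R ((1 + \<kappa>) *\<^sub>R f - d)"
  proof -
    have "1 - \<delta> = 1 / (1 + \<kappa>)" using \<open>\<kappa> > 0\<close> by (simp add: \<delta> field_simps)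
    then show ?thesis using \<open>\<kappa> > 0\<close> by (simp add: scaleR_diff_right)
  qed
  ultimately have "norm (f - (1 - \<delta>) *\<^sub>R d) \<le> 1 / (1 + \<kappa>) * (\<kappa> * norm d)"
    using \<open>\<kappa> > 0\<close> by (simp add: divide_right_mono)
  then show ?thesis by (simp add: \<delta> d_def f_def)
qed

lemma converges_with_rate_contraction:
  fixes T :: "'a::{real_normed_vector,complete_space} \<Rightarrow> 'a"
  assumes "0 \<le> \<rho>" "\<rho> < 1" "\<And>x y. norm (T x - T y) \<le> \<rho> * norm (x - y)"
  shows "converges_with_rate T \<rho>"
proof -
  have "\<exists>!x. T x = x"
    using banach_fix_type[of \<rho> T] assms by (auto simp: dist_norm)
  then obtain zbar where zbar: "\<And>z. T z = z \<longleftrightarrow> z = zbar" by metis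
  then have "norm (T z - zbar) \<le> \<rho> * norm (z - zbar)" for z
    using assms(3)[of z zbar] by (metis (full_types))
  with zbar show ?thesis using assms(1,2) unfolding converges_with_rate_def by metis
qed

lemma DR_operator_contraction:
  fixes A :: "'a::{real_inner,complete_space} \<Rightarrow> 'a set"
  assumes "\<sigma> > 0" "\<beta> > 0" "maximally_monotone A" "strongly_monotone \<sigma> A"
    "maximally_monotone (op_of B)" "cocoercive (1 / \<beta>) B" "\<alpha> > 0" "\<gamma> > 0"
  shows "norm (DR_operator \<alpha> \<gamma> A B x - DR_operator \<alpha> \<gamma> A B y) \<le> DR_rate \<sigma> \<beta> \<alpha> \<gamma> * norm (x - y)"
proof -
  define \<kappa> where "\<kappa> = 1 / (\<gamma> * \<sigma>) + \<gamma> * \<beta>"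
  define \<delta> where "\<delta> = \<kappa> / (1 + \<kappa>)"
  define P where "P = (\<lambda>z. - reflected_resolvent (op_scale \<gamma> A)
                              (reflected_resolvent (op_scale \<gamma> (op_of B)) z))"
  have "averaged_map \<kappa> P"
    unfolding \<kappa>_def P_def
    using averaged_map_compose[OF averaged_map_reflected_resolvent_strongly_monotone
        averaged_map_reflected_resolvent_cocoercive] assms by simp
  moreover have "\<kappa> > 0" using assms by (simp add: \<kappa>_def add_pos_pos)
  ultimately have P: "norm ((P x - P y) - (1 - \<delta>) *\<^sub>R (x - y)) \<le> \<delta> * norm (x - y)"
    using averaged_map_dist_le \<delta>_def by blast
  have DR: "DR_operator \<alpha> \<gamma> A B z = (1 - \<alpha>) *\<^sub>R z - \<alpha> *\<^sub>R P z" for z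
    by (simp add: DR_operator_def P_def)
  have "DR_operator \<alpha> \<gamma> A B x - DR_operator \<alpha> \<gamma> A B y =
      (1 - 2 * \<alpha> + \<alpha> * \<delta>) *\<^sub>R (x - y) - \<alpha> *\<^sub>R ((P x - P y) - (1 - \<delta>) *\<^sub>R (x - y))"
  proof -
    have "1 - 2 * \<alpha> + \<alpha> * \<delta> = (1 - \<alpha>) - \<alpha> * (1 - \<delta>)" by (simp add: algebra_simps)
    then have "(1 - 2 * \<alpha> + \<alpha> * \<delta>) *\<^sub>R (x - y) =
        (1 - \<alpha>) *\<^sub>R (x - y) - \<alpha> *\<^sub>R (1 - \<delta>) *\<^sub>R (x - y)"
      by (simp only: scaleR_left_diff_distrib[of "1 - \<alpha>"] scaleR_scaleR)
    then show ?thesis by (simp add: DR scaleR_right_diff_distrib)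
  qed
  also have "norm \<dots> \<le> norm ((1 - 2 * \<alpha> + \<alpha> * \<delta>) *\<^sub>R (x - y)) +
      norm (\<alpha> *\<^sub>R ((P x - P y) - (1 - \<delta>) *\<^sub>R (x - y)))"
    by (rule norm_triangle_ineq4)
  also have "\<dots> \<le> \<bar>1 - 2 * \<alpha> + \<alpha> * \<delta>\<bar> * norm (x - y) + \<alpha> * (\<delta> * norm (x - y))"
    using P \<open>\<alpha> > 0\<close> by simp
  also have "\<dots> = DR_rate \<sigma> \<beta> \<alpha> \<gamma> * norm (x - y)"
    by (simp add: DR_rate_def Let_def \<delta>_def \<kappa>_def algebra_simps)
  finally show ?thesis .
qed

section \<open>The rate factor and its minimization\<close>

lemma DR_rate_eq:
  assumes "\<kappa> = 1 / (\<gamma> * \<sigma>) + \<gamma> * \<beta>" "\<kappa> > 0"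
  shows "DR_rate \<sigma> \<beta> \<alpha> \<gamma> = (\<bar>1 + \<kappa> - \<alpha> * (2 + \<kappa>)\<bar> + \<alpha> * \<kappa>) / (1 + \<kappa>)"
proof -
  have "1 - 2 * \<alpha> + \<alpha> * (\<kappa> / (1 + \<kappa>)) = (1 + \<kappa> - \<alpha> * (2 + \<kappa>)) / (1 + \<kappa>)"
    using assms(2) by (simp add: field_simps)
  then have "\<bar>1 - 2 * \<alpha> + \<alpha> * (\<kappa> / (1 + \<kappa>))\<bar> = \<bar>1 + \<kappa> - \<alpha> * (2 + \<kappa>)\<bar> / (1 + \<kappa>)"
    using assms(2) by simp
  moreover have "DR_rate \<sigma> \<beta> \<alpha> \<gamma> = \<bar>1 - 2 * \<alpha> + \<alpha> * (\<kappa> / (1 + \<kappa>))\<bar> + \<alpha> * (\<kappa> / (1 + \<kappa>))"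
    by (simp add: DR_rate_def Let_def assms(1) add.assoc)
  ultimately show ?thesis by (simp add: add_divide_distrib)
qed

lemma DR_rate_nonneg_less_1:
  assumes "\<sigma> > 0" "\<beta> > 0" "0 < \<alpha>" "\<alpha> < 1" "0 < \<gamma>"
  shows "0 \<le> DR_rate \<sigma> \<beta> \<alpha> \<gamma>" "DR_rate \<sigma> \<beta> \<alpha> \<gamma> < 1"
proof -
  define \<kappa> where "\<kappa> = 1 / (\<gamma> * \<sigma>) + \<gamma> * \<beta>"
  have "\<kappa> > 0" using assms by (simp add: \<kappa>_def add_pos_pos)
  note eq = DR_rate_eq[OF \<kappa>_def this]
  show "0 \<le> DR_rate \<sigma> \<beta> \<alpha> \<gamma>" unfolding eq using \<open>\<kappa> > 0\<close> assms by simp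
  have "\<alpha> * \<kappa> < \<kappa>" using assms \<open>\<kappa> > 0\<close> by simp
  then have "\<bar>1 + \<kappa> - \<alpha> * (2 + \<kappa>)\<bar> + \<alpha> * \<kappa> < 1 + \<kappa>"
    using assms unfolding distrib_left by argo
  then show "DR_rate \<sigma> \<beta> \<alpha> \<gamma> < 1" unfolding eq using \<open>\<kappa> > 0\<close> by simp
qed

text \<open>
  Here \<open>\<kappa>\<close> stands for \<open>1 / (\<gamma> \<sigma>) + \<gamma> \<beta>\<close>. For fixed \<open>\<gamma>\<close> the minimum over \<open>\<alpha>\<close> is attained only where the absolute value
  vanishes.
\<close>

lemma rate_lower_bound:
  fixes \<kappa> \<alpha> :: real
  assumes "\<kappa> > 0"
  shows "\<kappa> / (2 + \<kappa>) \<le> (\<bar>1 + \<kappa> - \<alpha> * (2 + \<kappa>)\<bar> + \<alpha> * \<kappa>) / (1 + \<kappa>)"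
    and "(\<bar>1 + \<kappa> - \<alpha> * (2 + \<kappa>)\<bar> + \<alpha> * \<kappa>) / (1 + \<kappa>) = \<kappa> / (2 + \<kappa>) \<Longrightarrow> \<alpha> * (2 + \<kappa>) = 1 + \<kappa>"
proof -
  define w where "w = 1 + \<kappa> - \<alpha> * (2 + \<kappa>)"
  have \<alpha>: "\<alpha> = (1 + \<kappa> - w) / (2 + \<kappa>)" using assms by (simp add: w_def field_simps)
  have "(\<bar>w\<bar> + \<alpha> * \<kappa>) / (1 + \<kappa>) - \<kappa> / (2 + \<kappa>) = (\<bar>w\<bar> * (2 + \<kappa>) - w * \<kappa>) / ((1 + \<kappa>) * (2 + \<kappa>))"
  proof -
    have "1 + \<kappa> \<noteq> 0" "2 + \<kappa> \<noteq> 0" using assms by auto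
    then show ?thesis unfolding \<alpha> by (simp add: divide_simps) (simp add: algebra_simps)
  qed
  moreover have "\<bar>w\<bar> * (2 + \<kappa>) - w * \<kappa> \<ge> 2 * \<bar>w\<bar>"
  proof -
    have "w * \<kappa> \<le> \<bar>w\<bar> * \<kappa>" using assms by (intro mult_right_mono) auto
    then show ?thesis by (simp add: algebra_simps)
  qed
  moreover have "(1 + \<kappa>) * (2 + \<kappa>) > 0" using assms by simp
  ultimately have *: "(\<bar>w\<bar> + \<alpha> * \<kappa>) / (1 + \<kappa>) - \<kappa> / (2 + \<kappa>) \<ge> 2 * \<bar>w\<bar> / ((1 + \<kappa>) * (2 + \<kappa>))"
    by (simp add: divide_right_mono)
  moreover have "2 * \<bar>w\<bar> / ((1 + \<kappa>) * (2 + \<kappa>)) \<ge> 0" using assms by simp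
  ultimately show "\<kappa> / (2 + \<kappa>) \<le> (\<bar>1 + \<kappa> - \<alpha> * (2 + \<kappa>)\<bar> + \<alpha> * \<kappa>) / (1 + \<kappa>)"
    unfolding w_def by linarith
  assume "(\<bar>1 + \<kappa> - \<alpha> * (2 + \<kappa>)\<bar> + \<alpha> * \<kappa>) / (1 + \<kappa>) = \<kappa> / (2 + \<kappa>)"
  with * have "2 * \<bar>w\<bar> / ((1 + \<kappa>) * (2 + \<kappa>)) \<le> 0" by (simp add: w_def)
  then have "w = 0" using \<open>(1 + \<kappa>) * (2 + \<kappa>) > 0\<close> by (auto simp: divide_le_0_iff)
  then show "\<alpha> * (2 + \<kappa>) = 1 + \<kappa>" by (simp add: w_def)
qed

lemma kappa_minimum:
  fixes \<sigma> \<beta> \<gamma> :: real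
  assumes "\<sigma> > 0" "\<beta> > 0" "\<gamma> > 0"
  shows "2 * sqrt (\<beta> / \<sigma>) \<le> 1 / (\<gamma> * \<sigma>) + \<gamma> * \<beta>"
    and "1 / (\<gamma> * \<sigma>) + \<gamma> * \<beta> = 2 * sqrt (\<beta> / \<sigma>) \<longleftrightarrow> \<gamma> = 1 / sqrt (\<beta> * \<sigma>)"
proof -
  define a where "a = sqrt \<sigma>"
  define b where "b = sqrt \<beta>"
  have ab: "a > 0" "b > 0" "\<sigma> = a\<^sup>2" "\<beta> = b\<^sup>2" using assms by (simp_all add: a_def b_def)
  have s: "sqrt (\<beta> / \<sigma>) = b / a" "sqrt (\<beta> * \<sigma>) = b * a"
    by (simp_all add: a_def b_def real_sqrt_divide real_sqrt_mult)
  have eq: "1 / (\<gamma> * \<sigma>) + \<gamma> * \<beta> - 2 * sqrt (\<beta> / \<sigma>) = (1 - \<gamma> * (b * a))\<^sup>2 / (\<gamma> * a\<^sup>2)"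
    unfolding s unfolding ab(3,4) using ab(1,2) assms(3)
    by (simp add: field_simps power2_eq_square)
  have "(1 - \<gamma> * (b * a))\<^sup>2 / (\<gamma> * a\<^sup>2) \<ge> 0" using assms by simp
  with eq show "2 * sqrt (\<beta> / \<sigma>) \<le> 1 / (\<gamma> * \<sigma>) + \<gamma> * \<beta>" by linarith
  have "1 / (\<gamma> * \<sigma>) + \<gamma> * \<beta> = 2 * sqrt (\<beta> / \<sigma>) \<longleftrightarrow> (1 - \<gamma> * (b * a))\<^sup>2 / (\<gamma> * a\<^sup>2) = 0"
    using eq by linarith
  also have "\<dots> \<longleftrightarrow> \<gamma> * (b * a) = 1" using assms ab(1) by auto
  also have "\<dots> \<longleftrightarrow> \<gamma> = 1 / sqrt (\<beta> * \<sigma>)"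
    unfolding s using ab(1,2) by (simp add: field_simps)
  finally show "1 / (\<gamma> * \<sigma>) + \<gamma> * \<beta> = 2 * sqrt (\<beta> / \<sigma>) \<longleftrightarrow> \<gamma> = 1 / sqrt (\<beta> * \<sigma>)" .
qed

lemma DR_rate_optimal_value:
  assumes "\<sigma> > 0" "\<beta> > 0" and s: "s = sqrt (\<beta> / \<sigma>)"
  shows "DR_rate \<sigma> \<beta> ((s + 1 / 2) / (1 + s)) (1 / sqrt (\<beta> * \<sigma>)) = s / (s + 1)"
proof -
  have "s > 0" using assms by simp
  have "2 * s = 1 / (1 / sqrt (\<beta> * \<sigma>) * \<sigma>) + 1 / sqrt (\<beta> * \<sigma>) * \<beta>"
    using kappa_minimum(2)[of \<sigma> \<beta> "1 / sqrt (\<beta> * \<sigma>)"] assms by simp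
  note eq = DR_rate_eq[OF this]
  have "(s + 1 / 2) / (1 + s) * (2 + 2 * s) = 1 + 2 * s" "1 + 2 * s > 0"
    using \<open>s > 0\<close> by (simp_all add: field_simps)
  moreover have "(s + 1 / 2) / (1 + s) * (2 * s) / (1 + 2 * s) = s / (s + 1)"
    using \<open>s > 0\<close> by (simp add: divide_simps) (simp add: algebra_simps)
  ultimately show ?thesis using \<open>s > 0\<close> by (subst eq) simp_all
qed

lemma DR_rate_optimal:
  assumes "\<sigma> > 0" "\<beta> > 0" "\<gamma> > 0" and s: "s = sqrt (\<beta> / \<sigma>)"
  shows "s / (s + 1) \<le> DR_rate \<sigma> \<beta> \<alpha> \<gamma>"
    and "DR_rate \<sigma> \<beta> \<alpha> \<gamma> = s / (s + 1) \<Longrightarrow>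
           \<alpha> = (s + 1 / 2) / (1 + s) \<and> \<gamma> = 1 / sqrt (\<beta> * \<sigma>)"
proof -
  define \<kappa> where "\<kappa> = 1 / (\<gamma> * \<sigma>) + \<gamma> * \<beta>"
  have "s > 0" using assms by simp
  have "\<kappa> > 0" using assms by (simp add: \<kappa>_def add_pos_pos)
  note eq = DR_rate_eq[OF \<kappa>_def this]
  have \<kappa>_ge: "2 * s \<le> \<kappa>" using kappa_minimum(1)[OF assms(1-3)] by (simp add: \<kappa>_def s)
  then have le1: "s / (s + 1) \<le> \<kappa> / (2 + \<kappa>)"
    using \<open>s > 0\<close> \<open>\<kappa> > 0\<close> by (simp add: field_simps)
  have le2: "\<kappa> / (2 + \<kappa>) \<le> DR_rate \<sigma> \<beta> \<alpha> \<gamma>"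
    unfolding eq by (rule rate_lower_bound(1)[OF \<open>\<kappa> > 0\<close>])
  show "s / (s + 1) \<le> DR_rate \<sigma> \<beta> \<alpha> \<gamma>" using le1 le2 by linarith
  assume "DR_rate \<sigma> \<beta> \<alpha> \<gamma> = s / (s + 1)"
  with le1 le2 have e1: "s / (s + 1) = \<kappa> / (2 + \<kappa>)" and e2: "DR_rate \<sigma> \<beta> \<alpha> \<gamma> = \<kappa> / (2 + \<kappa>)"
    by linarith+
  from e1 have \<kappa>: "\<kappa> = 2 * s" using \<open>s > 0\<close> \<open>\<kappa> > 0\<close> by (simp add: field_simps)
  then have "\<gamma> = 1 / sqrt (\<beta> * \<sigma>)"
    using kappa_minimum(2)[OF assms(1-3)] by (simp add: \<kappa>_def s)
  moreover have "\<alpha> * (2 + \<kappa>) = 1 + \<kappa>"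
    using rate_lower_bound(2)[OF \<open>\<kappa> > 0\<close>] e2 unfolding eq by blast
  then have "\<alpha> = (s + 1 / 2) / (1 + s)" unfolding \<kappa> using \<open>s > 0\<close> by (simp add: field_simps)
  ultimately show "\<alpha> = (s + 1 / 2) / (1 + s) \<and> \<gamma> = 1 / sqrt (\<beta> * \<sigma>)" by blast
qed

theorem theorem5p6:
  fixes A :: "'a::{real_inner, complete_space} \<Rightarrow> 'a set"
    and B :: "'a \<Rightarrow> 'a"
    and \<sigma> \<beta> :: real
  assumes "\<exists>D :: 'a set. countable D \<and> closure D = UNIV"
    and "\<sigma> > 0" and "\<beta> > 0"
    and "maximally_monotone A" and "strongly_monotone \<sigma> A"
    and "maximally_monotone (op_of B)" and "cocoercive (1 / \<beta>) B"
  shows "(\<forall>\<alpha> \<gamma>. 0 < \<alpha> \<and> \<alpha> < 1 \<and> 0 < \<gamma> \<longrightarrow>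
            converges_with_rate (DR_operator \<alpha> \<gamma> A B) (DR_rate \<sigma> \<beta> \<alpha> \<gamma>)) \<and>
         {p. is_arg_min (\<lambda>(\<alpha>, \<gamma>). DR_rate \<sigma> \<beta> \<alpha> \<gamma>) (\<lambda>(\<alpha>, \<gamma>). 0 < \<alpha> \<and> \<alpha> < 1 \<and> 0 < \<gamma>) p} =
           {((sqrt (\<beta> / \<sigma>) + 1 / 2) / (1 + sqrt (\<beta> / \<sigma>)), 1 / sqrt (\<beta> * \<sigma>))} \<and>
         DR_rate \<sigma> \<beta> ((sqrt (\<beta> / \<sigma>) + 1 / 2) / (1 + sqrt (\<beta> / \<sigma>))) (1 / sqrt (\<beta> * \<sigma>)) =
           sqrt (\<beta> / \<sigma>) / (sqrt (\<beta> / \<sigma>) + 1)"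
proof (intro conjI)
  show "\<forall>\<alpha> \<gamma>. 0 < \<alpha> \<and> \<alpha> < 1 \<and> 0 < \<gamma> \<longrightarrow>
      converges_with_rate (DR_operator \<alpha> \<gamma> A B) (DR_rate \<sigma> \<beta> \<alpha> \<gamma>)"
    using DR_rate_nonneg_less_1 DR_operator_contraction assms
    by (intro allI impI converges_with_rate_contraction) auto
next
  define s where "s = sqrt (\<beta> / \<sigma>)"
  define p0 where "p0 = ((s + 1 / 2) / (1 + s), 1 / sqrt (\<beta> * \<sigma>))"
  define f where "f = (\<lambda>(\<alpha>, \<gamma>). DR_rate \<sigma> \<beta> \<alpha> \<gamma>)"
  define Q :: "real \<times> real \<Rightarrow> bool" where "Q = (\<lambda>(\<alpha>, \<gamma>). 0 < \<alpha> \<and> \<alpha> < 1 \<and> 0 < \<gamma>)"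
  have "s > 0" using assms(2,3) by (simp add: s_def)
  have Q0: "Q p0" using \<open>s > 0\<close> assms(2,3) by (simp add: Q_def p0_def field_simps)
  \<comment> \<open>Every admissible pair has a rate of at least \<open>s / (s + 1)\<close>, with equality only at \<open>p0\<close>.\<close>
  have val: "f p0 = s / (s + 1)"
    using DR_rate_optimal_value[OF assms(2,3) s_def] by (simp add: f_def p0_def)
  have lower: "s / (s + 1) \<le> f p" and uniq: "f p = s / (s + 1) \<Longrightarrow> p = p0" if "Q p" for p
    using DR_rate_optimal[OF assms(2,3) _ s_def, of "snd p" "fst p"] that
    by (auto simp: f_def Q_def p0_def split: prod.splits)
  have "is_arg_min f Q p \<longleftrightarrow> p = p0" for p
  proof
    assume "is_arg_min f Q p"
    then have "Q p" "f p \<le> f p0" using Q0 by (simp_all add: is_arg_min_linorder del: split_paired_All)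
    with lower[of p] uniq[of p] val show "p = p0" by simp
  next
    assume "p = p0"
    then show "is_arg_min f Q p" using Q0 val lower by (simp add: is_arg_min_linorder)
  qed
  then show "{p. is_arg_min (\<lambda>(\<alpha>, \<gamma>). DR_rate \<sigma> \<beta> \<alpha> \<gamma>) (\<lambda>(\<alpha>, \<gamma>). 0 < \<alpha> \<and> \<alpha> < 1 \<and> 0 < \<gamma>) p} =
      {((sqrt (\<beta> / \<sigma>) + 1 / 2) / (1 + sqrt (\<beta> / \<sigma>)), 1 / sqrt (\<beta> * \<sigma>))}"
    by (auto simp: f_def Q_def p0_def s_def)
next
  show "DR_rate \<sigma> \<beta> ((sqrt (\<beta> / \<sigma>) + 1 / 2) / (1 + sqrt (\<beta> / \<sigma>))) (1 / sqrt (\<beta> * \<sigma>)) =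
      sqrt (\<beta> / \<sigma>) / (sqrt (\<beta> / \<sigma>) + 1)"
    using DR_rate_optimal_value[OF assms(2,3) refl] .
qed

end
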